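(* Let $(\alpha_j)_{j\ge 0}$ be a sequence of formal power series in $q$ with $\alpha_0=1$, such that the sum $\sum_{j\ge0}\alpha_j/(q;q)_j$ converges as a formal power series in $q$. Then for any positive integer $M$, $$ \frac{1-q^M}{1-wq^M}\sum_{j=0}^\infty \frac{\alpha_j}{(q;q)_j}= 1+\frac{\alpha_1[M]_q-q^M+wq^M}{1-wq^M}+\sum_{j=2}^\infty \frac{[M]_q}{1-wq^M}\,\frac{\alpha_j}{(q^2;q)_{j-1}} . $$
   Context: Here $w$ is an indeterminate and the identity is one of formal power series in $q$ with coefficients polynomial in $w$. Notation: $(A;q)_k=\prod_{i=0}^{k-1}(1-Aq^i)$ and $[M]_q=\frac{1-q^M}{1-q}=1+q+\cdots+q^{M-1}$. *)

theory Defs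
  imports "HOL-Computational_Algebra.Computational_Algebra"
begin

(* All series live in R[w][[q]], i.e. in the type 'a poly fps: the power series variable
   fps_X is q, and the polynomial variable of the coefficients is w. *)

abbreviation q :: "'a::comm_ring_1 poly fps"
  where "q \<equiv> fps_X"

abbreviation w :: "'a::comm_ring_1 poly fps"
  where "w \<equiv> fps_const [:0, 1:]"

(* The library's division on fps needs an inverse operation on the coefficients, which R[w] does
   not have. This quotient is meant for denominators with constant term 1 (see fps_quot_mult);
   for other denominators it has no meaning. *)
definition fps_quot :: "'a::comm_ring_1 fps \<Rightarrow> 'a fps \<Rightarrow> 'a fps"  (infixl "\<oslash>" 70)
  where "f \<oslash> g = f * fps_right_inverse g 1"

lemma fps_quot_mult:
  assumes "fps_nth g 0 = 1"
  shows "(f \<oslash> g) * g = f"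
proof -
  have inv: "g * fps_right_inverse g 1 = 1"
    by (rule fps_right_inverse) (simp add: assms)
  have "(f \<oslash> g) * g = f * (g * fps_right_inverse g 1)"
    by (simp only: fps_quot_def mult_ac)
  then show ?thesis
    by (simp only: inv mult_1_right)
qed

definition qpoch :: "'a::comm_ring_1 poly fps \<Rightarrow> nat \<Rightarrow> 'a poly fps"
  where "qpoch A k = (\<Prod>i<k. 1 - A * q ^ i)"

definition qint :: "nat \<Rightarrow> 'a::comm_ring_1 poly fps"
  where "qint M = (1 - q ^ M) \<oslash> (1 - q)"

lemma qint_eq_sum: "qint M = (\<Sum>i<M. q ^ i)"
proof -
  let ?g = "1 - q :: 'a poly fps"
  have inv: "?g * fps_right_inverse ?g 1 = 1"
    by (rule fps_right_inverse) simp
  have "qint M = (?g * fps_right_inverse ?g 1) * (\<Sum>i<M. q ^ i)"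
    by (simp only: qint_def fps_quot_def one_diff_power_eq mult_ac)
  then show ?thesis
    by (simp only: inv mult_1_left)
qed

end

theory Submission
  imports Defs
begin

text \<open>
  Put \<open>c = (1 - q\<^sup>M) / (1 - w q\<^sup>M)\<close>. The identity is the expansion of \<open>c \<Sum>\<^sub>j \<alpha>\<^sub>j / (q;q)\<^sub>j\<close> term by
  term, with the terms \<open>j = 0\<close> and \<open>j = 1\<close> split off. In every term with \<open>j \<ge> 1\<close> the factor
  \<open>1 - q\<close> of \<open>1 - q\<^sup>M = (1 - q) [M]\<^sub>q\<close> cancels the first factor of
  \<open>(q;q)\<^sub>j = (1 - q) (q\<^sup>2;q)\<^sub>j\<^sub>-\<^sub>1\<close> (lemma \<open>qpoch_q_Suc\<close>), while the term \<open>j = 0\<close> is \<open>c\<close> itself,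
  that is \<open>1 + (w q\<^sup>M - q\<^sup>M) / (1 - w q\<^sup>M)\<close>.

  Termwise multiplication and splitting are legitimate because a coefficient of a product of power
  series involves only finitely many coefficients of each factor, so that multiplication by a fixed
  series and subtraction of a fixed series are continuous for coefficientwise convergence
  (lemma \<open>fps_sums_mult_shift\<close>).
\<close>

text \<open>
  Convergence means that each coefficient is eventually constant, and the coefficient of index \<open>n\<close>
  of \<open>c * (f x - d)\<close> is determined by the coefficients of \<open>f x\<close> of index at most \<open>n\<close>.
\<close>

lemma fps_tendsto_mult_diff_const:
  fixes c d l :: "'a::comm_ring_1 fps"
  assumes "(f \<longlongrightarrow> l) F"
  shows "((\<lambda>x. c * (f x - d)) \<longlongrightarrow> c * (l - d)) F"
proof (rule tendsto_fpsI)
  fix n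
  have "\<forall>\<^sub>F x in F. \<forall>k\<in>{..n}. fps_nth (f x) k = fps_nth l k"
    using assms by (intro eventually_ball_finite) (simp_all add: tendsto_fps_iff)
  then show "\<forall>\<^sub>F x in F. fps_nth (c * (f x - d)) n = fps_nth (c * (l - d)) n"
    by eventually_elim (auto simp: fps_mult_nth intro!: sum.cong)
qed

lemma fps_sums_mult_shift:
  fixes c s :: "'a::comm_ring_1 fps"
  assumes "f sums s"
  shows "(\<lambda>j. c * f (j + k)) sums (c * (s - (\<Sum>i<k. f i)))"
proof -
  have "(\<Sum>j<n. c * f (j + k)) = c * ((\<Sum>j<n + k. f j) - (\<Sum>i<k. f i))" for n
    by (induction n) (simp_all add: algebra_simps)
  moreover have "(\<lambda>n. \<Sum>j<n + k. f j) \<longlonglongrightarrow> s"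
    using assms unfolding sums_def by (rule LIMSEQ_ignore_initial_segment)
  ultimately show ?thesis
    unfolding sums_def by (simp add: fps_tendsto_mult_diff_const)
qed

lemma fps_quot_unique:
  assumes "fps_nth g 0 = 1" and "x * g = f"
  shows "x = f \<oslash> g"
proof -
  have "g * fps_right_inverse g 1 = 1"
    by (rule fps_right_inverse) (simp add: assms(1))
  then show ?thesis
    unfolding fps_quot_def assms(2)[symmetric] by (simp add: mult.assoc)
qed

lemma fps_quot_cancel_factor:
  assumes "fps_nth g 0 = 1" and "fps_nth h 0 = 1"
  shows "g * (f \<oslash> (g * h)) = f \<oslash> h"
proof (rule fps_quot_unique[OF assms(2)])
  have "(f \<oslash> (g * h)) * (g * h) = f"
    by (rule fps_quot_mult) (simp add: assms)
  then show "g * (f \<oslash> (g * h)) * h = f"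
    by (simp add: mult_ac)
qed

lemma qpoch_nth_0: "0 < n \<Longrightarrow> fps_nth (qpoch (q ^ n) k) 0 = 1"
  unfolding qpoch_def by (induction k) simp_all

lemma qpoch_q_Suc: "qpoch q (Suc n) = (1 - q) * qpoch (q ^ 2) n"
  unfolding qpoch_def prod.lessThan_Suc_shift by (simp add: power2_eq_square mult.assoc)

lemma qint_mult: "(1 - q) * qint M = 1 - q ^ M"
  by (simp add: qint_eq_sum one_diff_power_eq)

theorem proposition3p1:
  fixes \<alpha> :: "nat \<Rightarrow> 'a::comm_ring_1 poly fps" and M :: nat
  assumes "\<alpha> 0 = 1"
    and "summable (\<lambda>j. \<alpha> j \<oslash> qpoch q j)"
    and "M > 0"
  shows "summable (\<lambda>j. (qint M \<oslash> (1 - w * q ^ M)) * (\<alpha> (j + 2) \<oslash> qpoch (q ^ 2) (j + 1))) \<and>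
    ((1 - q ^ M) \<oslash> (1 - w * q ^ M)) * (\<Sum>j. \<alpha> j \<oslash> qpoch q j) =
      1 + (\<alpha> 1 * qint M - q ^ M + w * q ^ M) \<oslash> (1 - w * q ^ M)
        + (\<Sum>j. (qint M \<oslash> (1 - w * q ^ M)) * (\<alpha> (j + 2) \<oslash> qpoch (q ^ 2) (j + 1)))"
proof -
  define D :: "'a poly fps" where "D = 1 - w * q ^ M"
  define I where "I = fps_right_inverse D 1"
  define c where "c = (1 - q ^ M) \<oslash> D"
  define S where "S j = \<alpha> j \<oslash> qpoch q j" for j

  \<comment> \<open>\<open>M > 0\<close> is what makes the constant term of the denominator \<open>D\<close> equal to 1.\<close>
  have DI: "D * I = 1"
    unfolding I_def by (rule fps_right_inverse) (use \<open>M > 0\<close> in \<open>simp add: D_def\<close>)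
  have c: "c = (qint M \<oslash> D) * (1 - q)"
    by (simp add: c_def fps_quot_def qint_mult[symmetric] mult_ac)
  have cS: "c * S (Suc j) = (qint M \<oslash> D) * (\<alpha> (Suc j) \<oslash> qpoch (q ^ 2) j)" for j
  proof -
    have "(1 - q) * S (Suc j) = \<alpha> (Suc j) \<oslash> qpoch (q ^ 2) j"
      unfolding S_def qpoch_q_Suc by (rule fps_quot_cancel_factor) (simp_all add: qpoch_nth_0)
    then show ?thesis
      by (simp add: c mult.assoc)
  qed

  have S0: "S 0 = 1"
    using fps_quot_unique[of 1 1 1] by (simp add: S_def qpoch_def \<open>\<alpha> 0 = 1\<close>)
  have S1: "c * S 1 = (qint M \<oslash> D) * \<alpha> 1"
    using cS[of 0] fps_quot_unique[of 1 "\<alpha> 1" "\<alpha> 1"] by (simp add: qpoch_def)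
  have head: "c * (\<Sum>i<2. S i) = 1 + (\<alpha> 1 * qint M - q ^ M + w * q ^ M) \<oslash> D"
  proof -
    have "c * (\<Sum>i<2. S i) = c + (qint M \<oslash> D) * \<alpha> 1"
      using S1 by (simp add: numeral_2_eq_2 S0 distrib_left)
    also have "\<dots> = (D + (\<alpha> 1 * qint M - q ^ M + w * q ^ M)) * I"
    proof -
      have "D + (\<alpha> 1 * qint M - q ^ M + w * q ^ M) = (1 - q ^ M) + qint M * \<alpha> 1"
        by (simp add: D_def algebra_simps)
      then show ?thesis
        by (simp only: c_def fps_quot_def I_def) (simp only: distrib_left mult_ac)
    qed
    also have "\<dots> = 1 + (\<alpha> 1 * qint M - q ^ M + w * q ^ M) \<oslash> D"
      by (simp add: distrib_right DI fps_quot_def I_def[symmetric])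
    finally show ?thesis .
  qed

  have "S sums (\<Sum>j. S j)"
    using assms(2) unfolding S_def by (rule summable_sums)
  then have "(\<lambda>j. c * S (j + 2)) sums (c * ((\<Sum>j. S j) - (\<Sum>i<2. S i)))"
    by (rule fps_sums_mult_shift)
  then have tail: "(\<lambda>j. (qint M \<oslash> D) * (\<alpha> (j + 2) \<oslash> qpoch (q ^ 2) (j + 1)))
      sums (c * (\<Sum>j. S j) - c * (\<Sum>i<2. S i))"
    using cS[of "j + 1" for j] by (simp add: right_diff_distrib)
  have "c * (\<Sum>j. S j) = c * (\<Sum>i<2. S i)
      + (\<Sum>j. (qint M \<oslash> D) * (\<alpha> (j + 2) \<oslash> qpoch (q ^ 2) (j + 1)))"
    using sums_unique[OF tail] by (simp add: algebra_simps)
  with tail show ?thesis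
    unfolding head unfolding c_def S_def D_def by (blast intro: sums_summable)
qed

end
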